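(* Let $p$ be a prime number with $p = 4k+1$ for an integer $k$, and let $d$ be a positive integer. There exist positive integers $u, v$ such that $(du, dv, duv)$ is a solution for $p$ (that is, $\frac{4}{p} = \frac{1}{du} + \frac{1}{dv} + \frac{1}{duv}$ with $du \le dv \le duv$) if and only if there exists a positive integer $n$ such that $$k+1 \equiv 3dn - d \pmod{4dn-1}.$$
   Context: For a positive integer $p$, a solution for $p$ is a triple $(x,y,z)$ of positive integers with $x \le y \le z$ and $\frac{4}{p} = \frac{1}{x} + \frac{1}{y} + \frac{1}{z}$. *)

theory Defs
  imports Complex_Main "HOL-Number_Theory.Cong" "HOL-Computational_Algebra.Primes"
begin

definition is_solution_for :: "nat \<Rightarrow> nat \<times> nat \<times> nat \<Rightarrow> bool" where
  "is_solution_for p = (\<lambda>(x, y, z).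
     0 < x \<and> 0 < y \<and> 0 < z \<and> x \<le> y \<and> y \<le> z \<and>
     (4 :: rat) / of_nat p = 1 / of_nat x + 1 / of_nat y + 1 / of_nat z)"

end

(* The triple (du, dv, duv) solves 4/p iff u <= v and 4duv = p(u + v + 1), and the congruence says
   that 4dn - 1 divides p + 4d, since 4 is a unit modulo 4dn - 1.
   In 4duv = p(u + v + 1) the odd prime p cannot divide d (4duv would be too large), so it
   divides u or v, say v = pn.  Then u + 1 = nm with m = 4du - p, and p + 4d = m(4dn - 1).
   Conversely, p + 4d = m(4dn - 1) gives the pair {nm - 1, pn}. *)
theory Submission
  imports Defs
begin

text \<open>Over the common denominator \<open>d * u * v\<close> the three fractions have numerator
  \<open>u + v + 1\<close>, and cross-multiplication clears the rationals. The order condition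
  between the last two entries is automatic because \<open>u\<close> is at least 1.\<close>

lemma is_solution_for_iff:
  fixes p d u v :: nat
  assumes "0 < p" "0 < d" "0 < u" "0 < v"
  shows "is_solution_for p (d * u, d * v, d * u * v) \<longleftrightarrow>
    u \<le> v \<and> 4 * d * u * v = p * (u + v + 1)"
proof -
  let ?l = "(4 :: rat) / of_nat p"
  let ?r = "1 / of_nat (d * u) + 1 / of_nat (d * v) + 1 / of_nat (d * u * v) :: rat"
  have "?l = ?r \<longleftrightarrow> (of_nat (4 * d * u * v) :: rat) = of_nat (p * (u + v + 1))"
  proof -
    have "?r = of_nat (u + v + 1) / of_nat (d * u * v)"
      using assms by (simp add: add_divide_distrib)
    moreover have "?l = of_nat (u + v + 1) / of_nat (d * u * v) \<longleftrightarrow>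
        4 * of_nat (d * u * v) = (of_nat (u + v + 1) * of_nat p :: rat)"
      using assms by (intro frac_eq_eq) simp_all
    ultimately have "?l = ?r \<longleftrightarrow> 4 * of_nat (d * u * v) = (of_nat (u + v + 1) * of_nat p :: rat)"
      by (simp only:)
    then show ?thesis by (simp only: of_nat_mult of_nat_numeral ac_simps)
  qed
  also have "\<dots> \<longleftrightarrow> 4 * d * u * v = p * (u + v + 1)"
    by (rule of_nat_eq_iff)
  finally have "?l = ?r \<longleftrightarrow> 4 * d * u * v = p * (u + v + 1)" .
  moreover have "0 < d * u" "0 < d * v" "0 < d * u * v" "d * v \<le> d * u * v"
      "d * u \<le> d * v \<longleftrightarrow> u \<le> v"
    using assms by simp_all
  ultimately show ?thesis
    by (simp only: is_solution_for_def prod.case simp_thms)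
qed

text \<open>Substituting \<open>4 * k = p - 1\<close>, four times the difference of the two sides
  equals \<open>p + 4 * d\<close> minus three times the modulus. The factor 4 is harmless, being
  coprime to the modulus.\<close>

lemma cong_iff_dvd:
  fixes p d n :: nat and k :: int
  assumes "int p = 4 * k + 1"
  shows "[k + 1 = 3 * int d * int n - int d] (mod (4 * int d * int n - 1)) \<longleftrightarrow>
    4 * int d * int n - 1 dvd int p + 4 * int d"
proof -
  let ?m = "4 * int d * int n - 1"
  let ?a = "k + 1 - (3 * int d * int n - int d)"
  have "coprime ?m 4"
  proof (rule coprimeI)
    fix c assume c: "c dvd ?m" "c dvd 4"
    have "c dvd 4 * (int d * int n) - ?m"
      by (rule dvd_diff[OF dvd_mult2[OF c(2)] c(1)])
    also have "4 * (int d * int n) - ?m = 1" by simp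
    finally show "is_unit c" .
  qed
  then have "?m dvd ?a \<longleftrightarrow> ?m dvd 4 * ?a"
    by (simp only: coprime_dvd_mult_right_iff)
  also have "4 * ?a = int p + 4 * int d + (-3) * ?m"
    using assms by (simp add: algebra_simps)
  also have "?m dvd \<dots> \<longleftrightarrow> ?m dvd int p + 4 * int d"
    by (rule dvd_add_times_triv_right_iff)
  finally show ?thesis by (simp only: cong_iff_dvd_diff)
qed

lemma prime_dvd_factor:
  fixes p d u v :: nat
  assumes "prime p" "odd p" "0 < d" "0 < u" "0 < v"
    and eq: "4 * d * u * v = p * (u + v + 1)"
  shows "p dvd u \<or> p dvd v"
proof -
  have "\<not> p dvd d"
  proof
    assume "p dvd d"
    then obtain e where e: "d = p * e" ..
    then have "0 < e" using \<open>0 < d\<close> by simp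
    have "p * (4 * e * u * v) = p * (u + v + 1)"
      using eq e by (simp add: algebra_simps)
    then have "4 * e * u * v = u + v + 1"
      using prime_gt_0_nat[OF \<open>prime p\<close>] by (simp only: mult_cancel1) auto
    moreover have "4 * (u * v) \<le> 4 * e * u * v"
      using \<open>0 < e\<close> by (simp add: mult.assoc)
    \<comment> \<open>Hence \<open>u + v + 1\<close> is at most \<open>3 * (u * v)\<close>, strictly
      below the lower bound \<open>4 * (u * v)\<close>.\<close>
    moreover have "u \<le> u * v" "v \<le> u * v" "1 \<le> u * v"
      using \<open>0 < u\<close> \<open>0 < v\<close> by (simp_all add: Suc_leI)
    ultimately show False by linarith
  qed
  moreover have "\<not> p dvd 4"
  proof
    assume "p dvd 4"
    then have "p dvd 2 ^ 2" by simp
    then have "p dvd 2" using \<open>prime p\<close> prime_dvd_power by blast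
    then show False using \<open>prime p\<close> \<open>odd p\<close>
      by (metis primes_dvd_imp_eq two_is_prime_nat)
  qed
  moreover have "p dvd 4 * d * u * v" using eq by simp
  ultimately show ?thesis using \<open>prime p\<close> by (simp add: prime_dvd_mult_iff)
qed

text \<open>No order between \<open>u\<close> and \<open>v\<close> is assumed, so the lemma also
  serves with the two exchanged.\<close>

lemma dvd_of_equation:
  fixes p d u v :: nat
  assumes "0 < v" and "p dvd v" and eq: "4 * d * u * v = p * (u + v + 1)"
  shows "\<exists>n>0. 4 * int d * int n - 1 dvd int p + 4 * int d"
proof -
  obtain n where n: "v = p * n" using \<open>p dvd v\<close> ..
  then have pos: "0 < p" "0 < n" using \<open>0 < v\<close> by simp_all
  have "p * (4 * d * u * n) = p * (u + p * n + 1)"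
    using eq n by (simp add: algebra_simps)
  then have "4 * d * u * n = u + p * n + 1"
    using pos by (simp only: mult_cancel1) auto
  then have "4 * int d * int u * int n = int u + int p * int n + 1"
    by (simp flip: of_nat_eq_iff[where ?'a = int])
  \<comment> \<open>The factor \<open>4 * d\<close> completes the product, with cofactor
    \<open>4 * d * u - p\<close>. Over the integers this difference needs no sign check.\<close>
  then have "4 * int d * (4 * int d * int u * int n) = 4 * int d * (int u + int p * int n + 1)"
    by simp
  then have "int p + 4 * int d = (4 * int d * int n - 1) * (4 * int d * int u - int p)"
    by (simp add: algebra_simps)
  then show ?thesis using pos by (metis dvd_triv_left)
qed

lemma equation_of_dvd:
  fixes p d n :: nat
  assumes "0 < p" "0 < d" "0 < n"
    and dvd: "4 * int d * int n - 1 dvd int p + 4 * int d"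
  shows "\<exists>u v. 0 < u \<and> 0 < v \<and> 4 * d * u * v = p * (u + v + 1)"
proof -
  obtain m where m: "int p + 4 * int d = (4 * int d * int n - 1) * m" using dvd ..
  then have m': "int p + 4 * int d = 4 * int d * int n * m - m"
    by (simp add: left_diff_distrib)
  have "0 < int d * int n" using assms by simp
  then have "0 < 4 * int d * int n - 1" by linarith
  moreover have "0 < (4 * int d * int n - 1) * m" using m[symmetric] \<open>0 < p\<close> by simp
  ultimately have "0 < m" by (simp only: zero_less_mult_pos)
  then have "0 < int n * m" using assms by simp
  \<comment> \<open>This excludes \<open>u = 0\<close>: with \<open>n * m = 1\<close> the equation
    \<open>m'\<close> would read \<open>p + 4 * d = 4 * d - m\<close>, impossible for positive
    \<open>p\<close> and \<open>m\<close>.\<close>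
  moreover have "int n * m \<noteq> 1"
  proof
    assume "int n * m = 1"
    then have "4 * int d * int n * m = 4 * int d" by (simp only: mult.assoc mult_1_right)
    then show False using m' \<open>0 < m\<close> \<open>0 < p\<close> by linarith
  qed
  ultimately have u: "0 < int n * m - 1" by linarith
  define u where "u = nat (int n * m - 1)"
  have iu: "int u = int n * m - 1" using u by (simp add: u_def)
  \<comment> \<open>This recovers \<open>m\<close> as \<open>4 * d * u - p\<close>, the cofactor of
    the forward direction. The next steps multiply by \<open>p * n\<close> and replace
    \<open>n * m\<close> by \<open>u + 1\<close>.\<close>
  have "4 * int d * int u = int p + m"
    unfolding iu using m' by (simp add: right_diff_distrib mult.assoc)
  then have "4 * int d * int u * (int p * int n) = (int p + m) * (int p * int n)" by simp
  also have "\<dots> = int p * (int u + int p * int n + 1)"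
    unfolding iu by (simp add: algebra_simps)
  finally have "int (4 * d * u * (p * n)) = int (p * (u + p * n + 1))"
    by (simp only: of_nat_mult of_nat_add of_nat_numeral of_nat_1)
  then have "4 * d * u * (p * n) = p * (u + p * n + 1)" by (simp only: of_nat_eq_iff)
  moreover have "0 < u" "0 < p * n" using u assms by (simp_all add: u_def)
  ultimately show ?thesis by blast
qed

theorem mainTheorem2:
  fixes p d :: nat and k :: int
  assumes "prime p" and "int p = 4 * k + 1" and "0 < d"
  shows "(\<exists>u v :: nat. 0 < u \<and> 0 < v \<and> is_solution_for p (d * u, d * v, d * u * v)) \<longleftrightarrow>
    (\<exists>n :: nat. 0 < n \<and>
       [k + 1 = 3 * int d * int n - int d] (mod (4 * int d * int n - 1)))"
proof -
  have "0 < p" using \<open>prime p\<close> by (rule prime_gt_0_nat)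
  have "odd p" using assms(2) by presburger
  have "(\<exists>u v. 0 < u \<and> 0 < v \<and> is_solution_for p (d * u, d * v, d * u * v)) \<longleftrightarrow>
      (\<exists>n>0. 4 * int d * int n - 1 dvd int p + 4 * int d)"
  proof
    assume "\<exists>u v. 0 < u \<and> 0 < v \<and> is_solution_for p (d * u, d * v, d * u * v)"
    then obtain u v where uv: "0 < u" "0 < v" and eq: "4 * d * u * v = p * (u + v + 1)"
      using is_solution_for_iff \<open>0 < p\<close> \<open>0 < d\<close> by blast
    \<comment> \<open>The equation is symmetric, so the case \<open>p dvd u\<close> reduces to the
      case \<open>p dvd v\<close>.\<close>
    have eq': "4 * d * v * u = p * (v + u + 1)" using eq by (simp add: ac_simps)
    show "\<exists>n>0. 4 * int d * int n - 1 dvd int p + 4 * int d"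
      using prime_dvd_factor[OF \<open>prime p\<close> \<open>odd p\<close> \<open>0 < d\<close> uv eq]
        dvd_of_equation[OF uv(2) _ eq] dvd_of_equation[OF uv(1) _ eq'] by blast
  next
    assume "\<exists>n>0. 4 * int d * int n - 1 dvd int p + 4 * int d"
    then obtain n where "0 < n" "4 * int d * int n - 1 dvd int p + 4 * int d" by blast
    from equation_of_dvd[OF \<open>0 < p\<close> \<open>0 < d\<close> this]
    obtain u v where uv: "0 < u" "0 < v" and eq: "4 * d * u * v = p * (u + v + 1)" by blast
    \<comment> \<open>Either of \<open>n * m - 1\<close> and \<open>p * n\<close> may be the
      smaller; by symmetry the pair can be put in increasing order.\<close>
    have eq': "4 * d * v * u = p * (v + u + 1)" using eq by (simp add: ac_simps)
    show "\<exists>u v. 0 < u \<and> 0 < v \<and> is_solution_for p (d * u, d * v, d * u * v)"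
      using is_solution_for_iff[OF \<open>0 < p\<close> \<open>0 < d\<close> uv]
        is_solution_for_iff[OF \<open>0 < p\<close> \<open>0 < d\<close> uv(2) uv(1)] uv eq eq' nat_le_linear[of u v]
      by blast
  qed
  then show ?thesis by (simp only: cong_iff_dvd[OF assms(2)])
qed

end
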